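(* Let $(\Gamma,m,f)$ be a Dyer graph such that the associated Dyer group $D_\Gamma$ is even. Then $D_\Gamma$ is quasi-perfect if and only if $\Gamma$ is complete and ($E(\Gamma)=\emptyset$ or $m(E(\Gamma))=\{2\}$).
   Context: A (simplicial) graph $\Gamma=(V,E)$ consists of a non-empty set $V$ and a subset $E\subseteq\{\{v,w\}\mid v,w\in V, v\neq w\}$. A Dyer graph is a triple $(\Gamma,m,f)$ consisting of a finite simplicial graph $\Gamma$, an edge labelling $m\colon E(\Gamma)\to\mathbb{N}_{\geq 2}$ and a vertex labelling $f\colon V(\Gamma)\to\mathbb{N}_{\geq 2}\cup\{\infty\}$ such that for every edge $e=\{v,w\}$ with $m(e)\neq 2$ we have $f(v)=f(w)=2$. For letters $a,b$ and $n\in\mathbb{N}$ let $\pi(a,b,n)=abab\ldots$ be the alternating word with $n$ letters starting with $a$. The associated Dyer group is $$D_\Gamma=\langle V(\Gamma)\mid v^{f(v)}=1\text{ if }f(v)\neq\infty,\ \pi(v,w,m(\{v,w\}))=\pi(w,v,m(\{v,w\}))\text{ if }\{v,w\}\in E(\Gamma)\rangle.$$ $D_\Gamma$ is called even if $E(\Gamma)=\emptyset$ or $m(E(\Gamma))\subseteq 2\mathbb{N}$. For a group $G$ put $G^{(0)}=G$ and $G^{(i+1)}=[G^{(i)},G^{(i)}]$. The derived length is ${\rm dl}(G)=\infty$ if $G^{(i)}\neq G^{(i+1)}$ for all $i\geq 0$, and otherwise ${\rm dl}(G)=\min\{i\mid G^{(i)}=G^{(i+1)}\}$. $G$ is quasi-perfect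 if ${\rm dl}(G)\in\{0,1\}$, i.e. $G$ or its commutator subgroup is perfect. *)

theory Defs
  imports "HOL-Algebra.Generated_Groups" "HOL-Library.Extended_Nat"
begin

section \<open>Groups given by generators and relations\<close>

text \<open>
  A letter \<open>(x, True)\<close> stands for the generator \<open>x\<close> and \<open>(x, False)\<close> for its formal inverse.
  A relation is a pair \<open>(r, s)\<close> of words, read as the equation \<open>r = s\<close>. The group
  \<open>\<langle>S | R\<rangle>\<close> is the monoid of words in the letters over \<open>S\<close>, modulo the least congruence
  that contains the free cancellations and the relations in \<open>R\<close>.
\<close>

type_synonym 'a gword = "('a \<times> bool) list"

abbreviation gwords :: "'a set \<Rightarrow> 'a gword set"
  where "gwords S \<equiv> lists (S \<times> UNIV)"

definition pos_word :: "'a list \<Rightarrow> 'a gword"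
  where "pos_word xs = map (\<lambda>x. (x, True)) xs"

inductive_set pres_cong :: "'a set \<Rightarrow> ('a gword \<times> 'a gword) set \<Rightarrow> ('a gword \<times> 'a gword) set"
  for S :: "'a set" and R :: "('a gword \<times> 'a gword) set"
  where
    refl: "w \<in> gwords S \<Longrightarrow> (w, w) \<in> pres_cong S R"
  | sym: "(v, w) \<in> pres_cong S R \<Longrightarrow> (w, v) \<in> pres_cong S R"
  | trans: "(u, v) \<in> pres_cong S R \<Longrightarrow> (v, w) \<in> pres_cong S R \<Longrightarrow> (u, w) \<in> pres_cong S R"
  | cancel: "u \<in> gwords S \<Longrightarrow> v \<in> gwords S \<Longrightarrow> x \<in> S \<Longrightarrow>
      (u @ [(x, b), (x, \<not> b)] @ v, u @ v) \<in> pres_cong S R"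
  | rel: "u \<in> gwords S \<Longrightarrow> v \<in> gwords S \<Longrightarrow> (r, s) \<in> R \<Longrightarrow> r \<in> gwords S \<Longrightarrow> s \<in> gwords S \<Longrightarrow>
      (u @ r @ v, u @ s @ v) \<in> pres_cong S R"

definition presented_group :: "'a set \<Rightarrow> ('a gword \<times> 'a gword) set \<Rightarrow> 'a gword set monoid"
  where "presented_group S R =
    \<lparr>carrier = gwords S // pres_cong S R,
     mult = (\<lambda>A B. \<Union>a\<in>A. \<Union>b\<in>B. pres_cong S R `` {a @ b}),
     one = pres_cong S R `` {[]}\<rparr>"

lemma pres_cong_gwords:
  assumes "(v, w) \<in> pres_cong S R"
  shows "v \<in> gwords S" "w \<in> gwords S"
  using assms by (induction) auto

lemma equiv_pres_cong: "equiv (gwords S) (pres_cong S R)"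
  by (rule equivI)
    (auto intro: refl_onI symI transI pres_cong.refl pres_cong.sym pres_cong.trans
      dest: pres_cong_gwords)

lemma pres_cong_context:
  assumes "(v, w) \<in> pres_cong S R" "u \<in> gwords S" "z \<in> gwords S"
  shows "(u @ v @ z, u @ w @ z) \<in> pres_cong S R"
  using assms
proof (induction)
  case (refl w)
  then show ?case by (intro pres_cong.refl) auto
next
  case (sym v w)
  then show ?case by (blast intro: pres_cong.sym)
next
  case (trans v w x)
  then show ?case by (blast intro: pres_cong.trans)
next
  case (cancel p q x b)
  then show ?case using pres_cong.cancel[of "u @ p" S "q @ z" x b R] by auto
next
  case (rel p q r s)
  then show ?case using pres_cong.rel[of "u @ p" S "q @ z" r s R] by auto
qed

lemma pres_cong_append:
  assumes "(v, w) \<in> pres_cong S R" "(v', w') \<in> pres_cong S R"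
  shows "(v @ v', w @ w') \<in> pres_cong S R"
proof -
  have "(v @ v', w @ v') \<in> pres_cong S R"
    using pres_cong_context[OF assms(1), of "[]" v'] pres_cong_gwords[OF assms(2)] by simp
  moreover have "(w @ v', w @ w') \<in> pres_cong S R"
    using pres_cong_context[OF assms(2), of w "[]"] pres_cong_gwords[OF assms(1)] by simp
  ultimately show ?thesis by (rule pres_cong.trans)
qed

lemma presented_group_mult:
  assumes "v \<in> gwords S" "w \<in> gwords S"
  shows "pres_cong S R `` {v} \<otimes>\<^bsub>presented_group S R\<^esub> pres_cong S R `` {w} =
    pres_cong S R `` {v @ w}"
proof -
  have "congruent2 (pres_cong S R) (pres_cong S R) (\<lambda>a b. pres_cong S R `` {a @ b})"
    using equiv_class_eq[OF equiv_pres_cong pres_cong_append]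
    by (intro congruent2I') blast
  from UN_equiv_class2[OF equiv_pres_cong equiv_pres_cong this assms]
  show ?thesis by (simp add: presented_group_def)
qed

definition inv_word :: "'a gword \<Rightarrow> 'a gword"
  where "inv_word w = rev (map (\<lambda>(x, b). (x, \<not> b)) w)"

lemma inv_word_gwords: "w \<in> gwords S \<Longrightarrow> inv_word w \<in> gwords S"
  by (auto simp: inv_word_def)

lemma inv_word_cancel:
  assumes "w \<in> gwords S"
  shows "(inv_word w @ w, []) \<in> pres_cong S R"
  using assms
proof (induction w rule: list.induct)
  case Nil
  then show ?case by (auto simp: inv_word_def intro: pres_cong.refl)
next
  case (Cons a w)
  obtain x b where a: "a = (x, b)" by (cases a)
  have w: "w \<in> gwords S" and x: "x \<in> S" using Cons.prems by (simp_all add: a)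
  have "(inv_word w @ [(x, \<not> b), (x, \<not> \<not> b)] @ w, inv_word w @ w) \<in> pres_cong S R"
    using inv_word_gwords[OF w] w x by (rule pres_cong.cancel)
  then show ?case
    using Cons.IH[OF w] by (auto simp: inv_word_def a intro: pres_cong.trans)
qed

lemma group_presented_group: "group (presented_group S R)"
proof (rule groupI)
  let ?G = "presented_group S R" and ?c = "\<lambda>w. pres_cong S R `` {w}"
  have rep: thesis if "A \<in> carrier ?G" "\<And>w. w \<in> gwords S \<Longrightarrow> A = ?c w \<Longrightarrow> thesis" for A thesis
    using that unfolding presented_group_def by (simp only: partial_object.simps) (erule quotientE)
  have cls: "?c w \<in> carrier ?G" if "w \<in> gwords S" for w
    using that by (simp add: presented_group_def quotientI)
  have one: "\<one>\<^bsub>?G\<^esub> = ?c []" by (simp add: presented_group_def)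
  have app: "v @ w \<in> gwords S" if "v \<in> gwords S" "w \<in> gwords S" for v w :: "'a gword"
    using that by simp
  have nil: "[] \<in> gwords S" by simp
  show "\<one>\<^bsub>?G\<^esub> \<in> carrier ?G" unfolding one by (rule cls[OF nil])
  show "A \<otimes>\<^bsub>?G\<^esub> B \<in> carrier ?G" if "A \<in> carrier ?G" "B \<in> carrier ?G" for A B
    by (rule rep[OF that(1)], rule rep[OF that(2)])
      (simp only: presented_group_mult cls app)
  show "A \<otimes>\<^bsub>?G\<^esub> B \<otimes>\<^bsub>?G\<^esub> C = A \<otimes>\<^bsub>?G\<^esub> (B \<otimes>\<^bsub>?G\<^esub> C)"
    if "A \<in> carrier ?G" "B \<in> carrier ?G" "C \<in> carrier ?G" for A B C
    by (rule rep[OF that(1)], rule rep[OF that(2)], rule rep[OF that(3)])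
      (simp only: presented_group_mult app append_assoc)
  show "\<one>\<^bsub>?G\<^esub> \<otimes>\<^bsub>?G\<^esub> A = A" if "A \<in> carrier ?G" for A
    by (rule rep[OF that]) (simp only: one presented_group_mult nil append_Nil)
  show "\<exists>B\<in>carrier ?G. B \<otimes>\<^bsub>?G\<^esub> A = \<one>\<^bsub>?G\<^esub>" if A: "A \<in> carrier ?G" for A
  proof -
    obtain w where w: "w \<in> gwords S" "A = ?c w" by (rule rep[OF A])
    have "?c (inv_word w) \<otimes>\<^bsub>?G\<^esub> A = \<one>\<^bsub>?G\<^esub>"
      using w equiv_class_eq[OF equiv_pres_cong inv_word_cancel[OF w(1)]]
      by (simp add: presented_group_mult inv_word_gwords one)
    then show ?thesis using cls[OF inv_word_gwords[OF w(1)]] by blast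
  qed
qed


section \<open>Dyer graphs and Dyer groups\<close>

locale simplicial_graph =
  fixes V :: "'a set" and E :: "'a set set"
  assumes vertices_nonempty: "V \<noteq> {}"
    and edges_subset: "E \<subseteq> {{v, w} |v w. v \<in> V \<and> w \<in> V \<and> v \<noteq> w}"

definition complete_graph :: "'a set \<Rightarrow> 'a set set \<Rightarrow> bool"
  where "complete_graph V E \<longleftrightarrow> (\<forall>v\<in>V. \<forall>w\<in>V. v \<noteq> w \<longrightarrow> {v, w} \<in> E)"

text \<open>The labellings are total functions; only their values on \<open>E\<close> and \<open>V\<close> matter.\<close>

locale dyer_graph = simplicial_graph V E
  for V :: "'a set" and E :: "'a set set" +
  fixes m :: "'a set \<Rightarrow> nat" and f :: "'a \<Rightarrow> enat"
  assumes finite_vertices: "finite V"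
    and edge_label: "e \<in> E \<Longrightarrow> 2 \<le> m e"
    and vertex_label: "v \<in> V \<Longrightarrow> 2 \<le> f v"
    and labels_compatible: "{v, w} \<in> E \<Longrightarrow> m {v, w} \<noteq> 2 \<Longrightarrow> f v = 2 \<and> f w = 2"

fun alternating_word :: "'a \<Rightarrow> 'a \<Rightarrow> nat \<Rightarrow> 'a list"
  where
    "alternating_word a b 0 = []"
  | "alternating_word a b (Suc n) = a # alternating_word b a n"

definition dyer_relations ::
  "'a set \<Rightarrow> 'a set set \<Rightarrow> ('a set \<Rightarrow> nat) \<Rightarrow> ('a \<Rightarrow> enat) \<Rightarrow> ('a gword \<times> 'a gword) set"
  where "dyer_relations V E m f =
    {(pos_word (replicate n v), []) |v n. v \<in> V \<and> f v = enat n} \<union>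
    {(pos_word (alternating_word v w (m {v, w})), pos_word (alternating_word w v (m {v, w}))) |v w.
      {v, w} \<in> E}"

definition dyer_group ::
  "'a set \<Rightarrow> 'a set set \<Rightarrow> ('a set \<Rightarrow> nat) \<Rightarrow> ('a \<Rightarrow> enat) \<Rightarrow> 'a gword set monoid"
  where "dyer_group V E m f = presented_group V (dyer_relations V E m f)"

text \<open>Evenness refers to the presentation, i.e. to the labelled graph, not to the abstract group.\<close>

definition even_dyer :: "'a set set \<Rightarrow> ('a set \<Rightarrow> nat) \<Rightarrow> bool"
  where "even_dyer E m \<longleftrightarrow> E = {} \<or> m ` E \<subseteq> {n. even n}"


section \<open>Derived length\<close>

definition derived_series :: "('a, 'b) monoid_scheme \<Rightarrow> nat \<Rightarrow> 'a set"
  where "derived_series G i = (derived G ^^ i) (carrier G)"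

definition derived_length :: "('a, 'b) monoid_scheme \<Rightarrow> enat"
  where "derived_length G =
    (if \<forall>i. derived_series G i \<noteq> derived_series G (Suc i) then \<infinity>
     else enat (LEAST i. derived_series G i = derived_series G (Suc i)))"

definition quasi_perfect :: "('a, 'b) monoid_scheme \<Rightarrow> bool"
  where "quasi_perfect G \<longleftrightarrow> derived_length G \<in> {0, 1}"

end

theory Submission
  imports Defs "HOL-Algebra.Solvable_Groups" Complex_Main
begin

text \<open>
  If \<open>G' = G''\<close>, then every solvable quotient of \<open>G\<close> is abelian. Let \<open>v\<close> and \<open>w\<close> be two
  vertices that are not adjacent, or joined by an edge of label \<open>2k \<ge> 4\<close>. Since all labels are
  even, killing the other generators respects the relations, and \<open>D_\<Gamma>\<close> maps to the
  solvable group of similarities of the complex plane so that the images of \<open>v\<close> and \<open>w\<close> do not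
  commute: without an edge, send them to rotations of suitable orders about two different centres;
  with an edge, to reflections whose product is a rotation of order dividing \<open>2k\<close> but not \<open>2\<close>.
\<close>

section \<open>Quasi-perfect groups\<close>

text \<open>The derived series is constant from its first repetition on, so a repetition at index 0
  forces one at index 1. A single equation therefore also covers perfect groups.\<close>

lemma quasi_perfect_iff: "quasi_perfect G \<longleftrightarrow> derived_series G 1 = derived_series G 2"
proof
  assume "quasi_perfect G"
  then obtain i where i: "i \<le> 1" "derived_length G = enat i"
    by (auto simp: quasi_perfect_def zero_enat_def one_enat_def)
  then have ex: "\<exists>i. derived_series G i = derived_series G (Suc i)"
    and "i = (LEAST i. derived_series G i = derived_series G (Suc i))"
    by (auto simp: derived_length_def split: if_splits)
  with LeastI_ex[OF ex] have "derived_series G i = derived_series G (Suc i)" by simp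
  with i(1) show "derived_series G 1 = derived_series G 2"
    by (cases i) (auto simp: derived_series_def numeral_2_eq_2)
next
  assume *: "derived_series G 1 = derived_series G 2"
  then have "(LEAST i. derived_series G i = derived_series G (Suc i)) \<le> 1"
    by (intro Least_le) (simp add: numeral_2_eq_2)
  moreover have "\<not> (\<forall>i. derived_series G i \<noteq> derived_series G (Suc i))"
    using * by (metis Suc_1)
  ultimately show "quasi_perfect G"
    by (auto simp: quasi_perfect_def derived_length_def zero_enat_def one_enat_def le_Suc_eq)
qed

lemma (in comm_group) quasi_perfect: "quasi_perfect G"
  by (simp add: quasi_perfect_iff derived_series_def numeral_2_eq_2 derived_eq_singleton)

text \<open>\<open>G'\<close> is its own derived subgroup, so its image lies in every term of the
  derived series of \<open>H\<close>. That series reaches the trivial group, hence all commutators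
  lie in the kernel.\<close>

lemma (in group_hom) quasi_perfect_hom_commute:
  assumes "quasi_perfect G" "solvable H" "x \<in> carrier G" "y \<in> carrier G"
  shows "h x \<otimes>\<^bsub>H\<^esub> h y = h y \<otimes>\<^bsub>H\<^esub> h x"
proof -
  obtain n where n: "(derived H ^^ n) (carrier H) = {\<one>\<^bsub>H\<^esub>}"
    using assms(2) H.solvable_iff_trivial_derived_seq by blast
  have "derived G (derived G (carrier G)) = derived G (carrier G)"
    using assms(1) by (simp add: quasi_perfect_iff derived_series_def numeral_2_eq_2)
  then have stable: "(derived G ^^ Suc k) (carrier G) = derived G (carrier G)" for k
    by (induction k) auto
  \<comment> \<open>The exponent is \<open>Suc n\<close> because \<open>stable\<close> speaks of
    positive iterates only: the zeroth one is the whole carrier.\<close>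
  have "h ` derived G (carrier G) = (derived H ^^ Suc n) (h ` carrier G)"
    using exp_of_derived_img[OF order_refl, of "Suc n"] stable[of n] by simp
  also have "\<dots> \<subseteq> (derived H ^^ Suc n) (carrier H)"
    by (intro H.mono_exp_of_derived) auto
  also have "\<dots> = {\<one>\<^bsub>H\<^esub>}"
    using n H.derived_incl[OF order_refl H.triv_subgroup]
      subgroup.one_closed[OF H.derived_is_subgroup, of "{\<one>\<^bsub>H\<^esub>}"] by auto
  finally have triv: "h ` derived G (carrier G) \<subseteq> {\<one>\<^bsub>H\<^esub>}" .
  have "x \<otimes> y \<otimes> inv x \<otimes> inv y \<in> derived G (carrier G)"
    unfolding derived_def using assms(3,4) by (intro generate.incl) blast
  with triv have "h (x \<otimes> y \<otimes> inv x \<otimes> inv y) = \<one>\<^bsub>H\<^esub>" by blast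
  then have "h x \<otimes>\<^bsub>H\<^esub> h y \<otimes>\<^bsub>H\<^esub> inv\<^bsub>H\<^esub> (h y \<otimes>\<^bsub>H\<^esub> h x) = \<one>\<^bsub>H\<^esub>"
    using assms(3,4) by (simp add: H.inv_mult_group H.m_assoc)
  then show ?thesis
    using assms(3,4) by (metis H.inv_closed H.inv_equality H.inv_inv H.m_closed hom_closed)
qed

text \<open>The commutator of \<open>x\<close> and \<open>y\<close> is the unique \<open>c\<close>
  with \<open>x \<otimes> y = c \<otimes> (y \<otimes> x)\<close>. Exhibiting such a
  \<open>c\<close> replaces computations with inverses when the derived series of a concrete group
  is bounded.\<close>

lemma (in group) derived_subset_subgroupI:
  assumes "K \<subseteq> carrier G" "subgroup N G"
    and "\<And>x y. x \<in> K \<Longrightarrow> y \<in> K \<Longrightarrow> \<exists>c\<in>N. x \<otimes> y = c \<otimes> (y \<otimes> x)"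
  shows "derived G K \<subseteq> N"
  unfolding derived_def
proof (rule generate_subgroup_incl[OF _ assms(2)], clarify)
  fix x y assume K: "x \<in> K" "y \<in> K"
  then have carr: "x \<in> carrier G" "y \<in> carrier G" using assms(1) by auto
  obtain c where c: "c \<in> N" "x \<otimes> y = c \<otimes> (y \<otimes> x)" using assms(3)[OF K] by blast
  have "c \<in> carrier G" using c(1) subgroup.subset[OF assms(2)] by auto
  then have "x \<otimes> y \<otimes> inv x \<otimes> inv y = c"
    using carr by (simp add: c(2) m_assoc flip: inv_mult_group)
  with c(1) show "x \<otimes> y \<otimes> inv x \<otimes> inv y \<in> N" by simp
qed


section \<open>Presented groups\<close>

lemma (in group) centralizer_subgroup:
  assumes "A \<subseteq> carrier G"
  shows "subgroup {x \<in> carrier G. \<forall>a\<in>A. x \<otimes> a = a \<otimes> x} G"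
proof (rule subgroupI)
  fix x assume x: "x \<in> {x \<in> carrier G. \<forall>a\<in>A. x \<otimes> a = a \<otimes> x}"
  have "inv x \<otimes> a = a \<otimes> inv x" if "a \<in> A" for a
  proof -
    have *: "x \<in> carrier G" "a \<in> carrier G" "x \<otimes> a = a \<otimes> x" using that x assms by auto
    then show ?thesis by (metis inv_closed inv_solve_left inv_solve_right m_assoc m_closed)
  qed
  then show "inv x \<in> {x \<in> carrier G. \<forall>a\<in>A. x \<otimes> a = a \<otimes> x}" using x by simp
next
  fix x y assume xy: "x \<in> {x \<in> carrier G. \<forall>a\<in>A. x \<otimes> a = a \<otimes> x}"
    "y \<in> {x \<in> carrier G. \<forall>a\<in>A. x \<otimes> a = a \<otimes> x}"
  have "x \<otimes> y \<otimes> a = a \<otimes> (x \<otimes> y)" if "a \<in> A" for a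
  proof -
    have *: "x \<in> carrier G" "y \<in> carrier G" "a \<in> carrier G" "x \<otimes> a = a \<otimes> x" "y \<otimes> a = a \<otimes> y"
      using that xy assms by auto
    then show ?thesis by (metis m_assoc)
  qed
  then show "x \<otimes> y \<in> {x \<in> carrier G. \<forall>a\<in>A. x \<otimes> a = a \<otimes> x}" using xy by simp
next
  have "\<one> \<in> {x \<in> carrier G. \<forall>a\<in>A. x \<otimes> a = a \<otimes> x}" using assms by auto
  then show "{x \<in> carrier G. \<forall>a\<in>A. x \<otimes> a = a \<otimes> x} \<noteq> {}" by blast
qed auto

text \<open>Two centralizers are used in turn. That of \<open>A\<close> contains \<open>A\<close>,
  hence is the whole group; so \<open>A\<close> lies in the centre, which is then the whole group as
  well.\<close>

lemma (in group) comm_group_if_generators_commute: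
  assumes "generate G A = carrier G" "A \<subseteq> carrier G"
    and "\<And>a b. a \<in> A \<Longrightarrow> b \<in> A \<Longrightarrow> a \<otimes> b = b \<otimes> a"
  shows "comm_group G"
proof (rule group_comm_groupI)
  have "generate G A \<subseteq> {x \<in> carrier G. \<forall>a\<in>A. x \<otimes> a = a \<otimes> x}"
    using assms by (intro generate_subgroup_incl centralizer_subgroup) auto
  then have "generate G A \<subseteq> {x \<in> carrier G. \<forall>a\<in>carrier G. x \<otimes> a = a \<otimes> x}"
    using assms by (intro generate_subgroup_incl centralizer_subgroup) auto
  then show "x \<otimes> y = y \<otimes> x" if "x \<in> carrier G" "y \<in> carrier G" for x y
    using that assms(1) by blast
qed

section \<open>Generators of a presented group\<close>

definition pres_gen :: "'a set \<Rightarrow> ('a gword \<times> 'a gword) set \<Rightarrow> 'a \<Rightarrow> 'a gword set"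
  where "pres_gen S R x = pres_cong S R `` {[(x, True)]}"

lemma pres_class_closed:
  "w \<in> gwords S \<Longrightarrow> pres_cong S R `` {w} \<in> carrier (presented_group S R)"
  by (simp add: presented_group_def quotientI)

lemma presented_group_carrierE:
  assumes "A \<in> carrier (presented_group S R)"
  obtains w where "w \<in> gwords S" "A = pres_cong S R `` {w}"
  using assms unfolding presented_group_def by (simp only: partial_object.simps) (erule quotientE)

lemma pres_gen_closed: "x \<in> S \<Longrightarrow> pres_gen S R x \<in> carrier (presented_group S R)"
  unfolding pres_gen_def by (intro pres_class_closed) simp

lemma inv_pres_gen:
  assumes "x \<in> S"
  shows "inv\<^bsub>presented_group S R\<^esub> pres_gen S R x = pres_cong S R `` {[(x, False)]}"
proof -
  interpret group "presented_group S R" by (rule group_presented_group)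
  have "([(x, False)] @ [(x, True)], []) \<in> pres_cong S R"
    using inv_word_cancel[of "[(x, True)]" S R] assms by (simp add: inv_word_def)
  from equiv_class_eq[OF equiv_pres_cong this]
  have "pres_cong S R `` {[(x, False)]} \<otimes>\<^bsub>presented_group S R\<^esub> pres_gen S R x =
      \<one>\<^bsub>presented_group S R\<^esub>"
    using assms unfolding pres_gen_def
    by (subst presented_group_mult) (simp_all add: presented_group_def)
  then show ?thesis
    using assms by (intro inv_equality pres_gen_closed pres_class_closed) auto
qed

lemma generate_pres_gen:
  "generate (presented_group S R) (pres_gen S R ` S) = carrier (presented_group S R)"
proof
  interpret group "presented_group S R" by (rule group_presented_group)
  show "generate (presented_group S R) (pres_gen S R ` S) \<subseteq> carrier (presented_group S R)"
    by (intro generate_incl) (auto intro: pres_gen_closed)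
  have "pres_cong S R `` {w} \<in> generate (presented_group S R) (pres_gen S R ` S)"
    if "w \<in> gwords S" for w
    using that
  proof (induction w rule: list.induct)
    case Nil
    then show ?case
      using generate.one[of "presented_group S R"] by (simp add: presented_group_def)
  next
    case (Cons a w)
    obtain x b where a: "a = (x, b)" by (cases a)
    have w: "w \<in> gwords S" and x: "x \<in> S" using Cons.prems by (simp_all add: a)
    have "pres_cong S R `` {[(x, b)]} \<in> generate (presented_group S R) (pres_gen S R ` S)"
    proof (cases b)
      case True
      then show ?thesis using x by (auto simp flip: pres_gen_def intro: generate.incl)
    next
      case False
      then show ?thesis using x by (auto simp flip: inv_pres_gen intro: generate.inv)
    qed
    from generate.eng[OF this Cons.IH[OF w]] show ?case
      using x w by (simp add: presented_group_mult a)
  qed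
  then show "carrier (presented_group S R) \<subseteq> generate (presented_group S R) (pres_gen S R ` S)"
    by (metis presented_group_carrierE subsetI)
qed

section \<open>Evaluation of words and the universal property of a presentation\<close>

definition word_eval :: "('c, 'd) monoid_scheme \<Rightarrow> ('a \<Rightarrow> 'c) \<Rightarrow> 'a gword \<Rightarrow> 'c"
  where "word_eval H g w =
    foldr (\<lambda>(x, b) y. (if b then g x else inv\<^bsub>H\<^esub> g x) \<otimes>\<^bsub>H\<^esub> y) w \<one>\<^bsub>H\<^esub>"

lemma word_eval_Nil [simp]: "word_eval H g [] = \<one>\<^bsub>H\<^esub>"
  and word_eval_Cons [simp]: "word_eval H g ((x, b) # w) =
    (if b then g x else inv\<^bsub>H\<^esub> g x) \<otimes>\<^bsub>H\<^esub> word_eval H g w"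
  by (simp_all add: word_eval_def)

context group
begin

lemma word_eval_closed:
  assumes "g \<in> S \<rightarrow> carrier G" "w \<in> gwords S"
  shows "word_eval G g w \<in> carrier G"
  using assms(2)
proof (induction w rule: list.induct)
  case (Cons a w)
  then show ?case using assms(1) by (cases a) (auto simp: Pi_iff)
qed simp

lemma word_eval_append:
  assumes g: "g \<in> S \<rightarrow> carrier G" and "v \<in> gwords S" and w: "w \<in> gwords S"
  shows "word_eval G g (v @ w) = word_eval G g v \<otimes> word_eval G g w"
  using assms(2)
proof (induction v rule: list.induct)
  case Nil
  then show ?case using word_eval_closed[OF g w] by simp
next
  case (Cons a v)
  obtain x b where a: "a = (x, b)" by (cases a)
  have v: "v \<in> gwords S" and x: "g x \<in> carrier G" using Cons.prems g by (auto simp: a)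
  show ?case
    using Cons.IH[OF v] word_eval_closed[OF g v] word_eval_closed[OF g w] x
    by (simp add: a m_assoc)
qed

text \<open>Having equal values is a congruence on words over \<open>S\<close>. It contains the free
  cancellations because \<open>G\<close> is a group and the relations by hypothesis, so it contains
  the least such congruence.\<close>

lemma word_eval_pres_cong:
  assumes g: "g \<in> S \<rightarrow> carrier G"
    and R: "\<And>r s. (r, s) \<in> R \<Longrightarrow> r \<in> gwords S \<Longrightarrow> s \<in> gwords S \<Longrightarrow>
      word_eval G g r = word_eval G g s"
    and "(v, w) \<in> pres_cong S R"
  shows "word_eval G g v = word_eval G g w"
  using assms(3)
proof induction
  case (cancel u v x b)
  have x: "g x \<in> carrier G" using cancel g by auto
  have "word_eval G g ([(x, b), (x, \<not> b)] @ v) = word_eval G g v"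
    using word_eval_closed[OF g cancel(2)] x by (cases b) (simp_all flip: m_assoc)
  then show ?case
    using cancel word_eval_append[OF g, of u "[(x, b), (x, \<not> b)] @ v"]
      word_eval_append[OF g, of u v] by simp
next
  case (rel u v r s)
  then show ?case using R[of r s] by (simp add: word_eval_append[OF g])
qed auto

text \<open>Von Dyck's theorem, the universal property of the presentation. The guards on
  \<open>r\<close> and \<open>s\<close> match those of the rule \<open>rel\<close> of
  \<open>pres_cong\<close>.\<close>

lemma presented_group_hom:
  assumes g: "g \<in> S \<rightarrow> carrier G"
    and R: "\<And>r s. (r, s) \<in> R \<Longrightarrow> r \<in> gwords S \<Longrightarrow> s \<in> gwords S \<Longrightarrow>
      word_eval G g r = word_eval G g s"
  obtains h where "h \<in> hom (presented_group S R) G"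
    and "\<And>x. x \<in> S \<Longrightarrow> h (pres_gen S R x) = g x"
proof
  \<comment> \<open>The value on a class is read off a chosen representative; the next fact shows
    that it is independent of the choice.\<close>
  define h where "h A = word_eval G g (SOME w. w \<in> A)" for A
  have h: "h (pres_cong S R `` {w}) = word_eval G g w" if "w \<in> gwords S" for w
  proof -
    have "w \<in> pres_cong S R `` {w}" using pres_cong.refl[OF that] by auto
    then have "(SOME v. v \<in> pres_cong S R `` {w}) \<in> pres_cong S R `` {w}" by (rule someI)
    then show ?thesis using word_eval_pres_cong[OF g R] by (auto simp: h_def)
  qed
  show "h \<in> hom (presented_group S R) G"
  proof (rule homI)
    fix A assume "A \<in> carrier (presented_group S R)"
    then obtain v where v: "v \<in> gwords S" "A = pres_cong S R `` {v}"
      by (rule presented_group_carrierE)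
    then show "h A \<in> carrier G" using word_eval_closed[OF g] by (simp only: h)
    fix B assume "B \<in> carrier (presented_group S R)"
    then obtain w where w: "w \<in> gwords S" "B = pres_cong S R `` {w}"
      by (rule presented_group_carrierE)
    have "v @ w \<in> gwords S" using v w by simp
    then show "h (A \<otimes>\<^bsub>presented_group S R\<^esub> B) = h A \<otimes> h B"
      using v w by (simp only: presented_group_mult h word_eval_append[OF g])
  qed
  show "h (pres_gen S R x) = g x" if "x \<in> S" for x
    using that g by (auto simp: pres_gen_def h Pi_iff)
qed

lemma word_eval_replicate:
  assumes "g v \<in> carrier G"
  shows "word_eval G g (pos_word (replicate n v)) = g v [^] n"
  using assms by (induction n) (simp_all add: pos_word_def nat_pow_Suc2 del: nat_pow_Suc Group.nat_pow_Suc)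

text \<open>An even alternating word is a power of a two-letter product. Evenness of the labels is
  exploited in this form: both sides of an edge relation become powers with the same
  exponent.\<close>

lemma word_eval_alternating:
  assumes "g v \<in> carrier G" "g w \<in> carrier G"
  shows "word_eval G g (pos_word (alternating_word v w (2 * n))) = (g v \<otimes> g w) [^] n"
  using assms by (induction n)
    (simp_all add: pos_word_def nat_pow_Suc2 m_assoc del: nat_pow_Suc Group.nat_pow_Suc)

end


section \<open>Similarities of the complex plane\<close>

text \<open>The flag \<open>s\<close> records reversal of orientation. The maps with
  \<open>a \<noteq> 0\<close> form the complex affine group extended by conjugation, which contains
  both the rotations and the reflections used below.\<close>

definition similarity :: "complex \<Rightarrow> complex \<Rightarrow> bool \<Rightarrow> complex \<Rightarrow> complex"
  where "similarity a b s z = a * (if s then cnj z else z) + b"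

text \<open>Elements are actual functions, so associativity is that of composition, and two elements
  can be told apart by their values at one point.\<close>

definition similarity_group :: "(complex \<Rightarrow> complex) monoid"
  where "similarity_group =
    \<lparr>carrier = {similarity a b s | a b s. a \<noteq> 0}, mult = (\<circ>), one = id\<rparr>"

lemma similarity_in_carrier: "a \<noteq> 0 \<Longrightarrow> similarity a b s \<in> carrier similarity_group"
  by (auto simp: similarity_group_def)

lemma similarity_carrierE:
  assumes "x \<in> carrier similarity_group"
  obtains a b s where "x = similarity a b s" "a \<noteq> 0"
  using assms by (auto simp: similarity_group_def)

text \<open>Conjugation is a field automorphism and can be pushed through the inner map. Two
  reversals cancel, so the flags combine by exclusive or, written
  \<open>s \<noteq> t\<close>.\<close>

lemma similarity_mult:
  "similarity a b s \<otimes>\<^bsub>similarity_group\<^esub> similarity c d t =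
    similarity (a * (if s then cnj c else c)) (a * (if s then cnj d else d) + b) (s \<noteq> t)"
  by (auto simp: similarity_group_def similarity_def algebra_simps)

lemma similarity_one: "\<one>\<^bsub>similarity_group\<^esub> = similarity 1 0 False"
  by (auto simp: similarity_group_def similarity_def)

text \<open>The formula comes from solving \<open>w = a * cnj z + b\<close> as
  \<open>z = (cnj w - cnj b) / cnj a\<close>, and likewise without conjugation.\<close>

lemma similarity_left_inverse:
  assumes "a \<noteq> 0"
  shows "similarity (inverse (if s then cnj a else a))
      (- ((if s then cnj b else b) / (if s then cnj a else a))) s
    \<otimes>\<^bsub>similarity_group\<^esub> similarity a b s = \<one>\<^bsub>similarity_group\<^esub>"
  using assms unfolding similarity_mult similarity_one by (simp add: field_simps)

lemma group_similarity_group: "group similarity_group"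
proof (rule groupI)
  fix x assume "x \<in> carrier similarity_group"
  then obtain a b s where "x = similarity a b s" "a \<noteq> 0" by (rule similarity_carrierE)
  then show "\<exists>y\<in>carrier similarity_group. y \<otimes>\<^bsub>similarity_group\<^esub> x = \<one>\<^bsub>similarity_group\<^esub>"
    using similarity_left_inverse
    by (intro bexI[of _ "similarity _ _ _"]) (auto intro!: similarity_in_carrier split: if_splits)
next
  show "x \<otimes>\<^bsub>similarity_group\<^esub> y \<in> carrier similarity_group"
    if "x \<in> carrier similarity_group" "y \<in> carrier similarity_group" for x y
    using that by (auto elim!: similarity_carrierE simp: similarity_mult intro!: similarity_in_carrier)
  show "\<one>\<^bsub>similarity_group\<^esub> \<in> carrier similarity_group"
    unfolding similarity_one by (rule similarity_in_carrier) simp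
qed (auto simp: similarity_group_def)

interpretation sim: group similarity_group
  by (rule group_similarity_group)

lemma inv_similarity:
  assumes "a \<noteq> 0"
  shows "inv\<^bsub>similarity_group\<^esub> similarity a b s =
    similarity (inverse (if s then cnj a else a))
      (- ((if s then cnj b else b) / (if s then cnj a else a))) s"
  using assms by (intro sim.inv_equality similarity_left_inverse similarity_in_carrier) auto

section \<open>The derived series of the similarity group\<close>

lemma similarity_orientation_subgroup:
  "subgroup {similarity a b False | a b. a \<noteq> 0} similarity_group"
proof (rule sim.subgroupI)
  have "similarity 1 0 False \<in> {similarity a b False | a b. a \<noteq> 0}" by force
  then show "{similarity a b False | a b. a \<noteq> 0} \<noteq> {}" by blast
qed (auto simp: inv_similarity similarity_mult intro!: similarity_in_carrier,
    (metis inverse_zero_imp_zero mult_eq_0_iff)+)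

lemma similarity_translation_subgroup:
  "subgroup {similarity 1 b False | b. True} similarity_group"
proof (rule sim.subgroupI)
qed (auto simp: inv_similarity similarity_mult intro!: similarity_in_carrier)

text \<open>Each derivation removes one layer: commutators preserve orientation, commutators of
  orientation-preserving maps have linear coefficient 1, and translations commute.\<close>

lemma solvable_similarity_group: "solvable similarity_group"
proof -
  let ?D = "derived similarity_group"
  have "?D (carrier similarity_group) \<subseteq> {similarity a b False | a b. a \<noteq> 0}"
  proof (rule sim.derived_subset_subgroupI[OF order_refl similarity_orientation_subgroup])
    fix x y assume xy: "x \<in> carrier similarity_group" "y \<in> carrier similarity_group"
    obtain a b s where x: "x = similarity a b s" "a \<noteq> 0" using xy(1) by (rule similarity_carrierE)
    obtain c d t where y: "y = similarity c d t" "c \<noteq> 0" using xy(2) by (rule similarity_carrierE)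
    \<comment> \<open>\<open>e\<close> is the quotient of the linear coefficients of the two
      products, which have the same orientation. The translation part below is then the one that
      matches their constant terms.\<close>
    define e where "e = a * (if s then cnj c else c) / (c * (if t then cnj a else a))"
    have "x \<otimes>\<^bsub>similarity_group\<^esub> y =
      similarity e (a * (if s then cnj d else d) + b - e * (c * (if t then cnj b else b) + d)) False
        \<otimes>\<^bsub>similarity_group\<^esub> (y \<otimes>\<^bsub>similarity_group\<^esub> x)"
      using x y by (auto simp: similarity_mult e_def)
    moreover have "e \<noteq> 0" using x y by (auto simp: e_def)
    ultimately show "\<exists>g\<in>{similarity a b False | a b. a \<noteq> 0}.
        x \<otimes>\<^bsub>similarity_group\<^esub> y = g \<otimes>\<^bsub>similarity_group\<^esub> (y \<otimes>\<^bsub>similarity_group\<^esub> x)"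
      by blast
  qed
  then have "?D (?D (carrier similarity_group)) \<subseteq> ?D {similarity a b False | a b. a \<noteq> 0}"
    by (rule sim.mono_derived)
  also have "\<dots> \<subseteq> {similarity 1 b False | b. True}"
  proof (rule sim.derived_subset_subgroupI[OF _ similarity_translation_subgroup])
    fix x y
    assume "x \<in> {similarity a b False | a b. a \<noteq> 0}" "y \<in> {similarity a b False | a b. a \<noteq> 0}"
    then obtain a b c d where "x = similarity a b False" "y = similarity c d False" by blast
    \<comment> \<open>Both products have linear coefficient \<open>a * c\<close>, so they differ by
      the translation along the difference of their constant terms.\<close>
    then have "x \<otimes>\<^bsub>similarity_group\<^esub> y = similarity 1 (a * d + b - (c * b + d)) False
        \<otimes>\<^bsub>similarity_group\<^esub> (y \<otimes>\<^bsub>similarity_group\<^esub> x)"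
      by (simp add: similarity_mult mult.commute)
    then show "\<exists>g\<in>{similarity 1 b False | b. True}.
        x \<otimes>\<^bsub>similarity_group\<^esub> y = g \<otimes>\<^bsub>similarity_group\<^esub> (y \<otimes>\<^bsub>similarity_group\<^esub> x)"
      by blast
  qed (auto intro: similarity_in_carrier)
  finally have "?D (?D (?D (carrier similarity_group))) \<subseteq> ?D {similarity 1 b False | b. True}"
    by (rule sim.mono_derived)
  also have "\<dots> \<subseteq> {\<one>\<^bsub>similarity_group\<^esub>}"
  proof (rule sim.derived_subset_subgroupI[OF _ sim.triv_subgroup])
    fix x y assume "x \<in> {similarity 1 b False | b. True}" "y \<in> {similarity 1 b False | b. True}"
    then show "\<exists>g\<in>{\<one>\<^bsub>similarity_group\<^esub>}.
        x \<otimes>\<^bsub>similarity_group\<^esub> y = g \<otimes>\<^bsub>similarity_group\<^esub> (y \<otimes>\<^bsub>similarity_group\<^esub> x)"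
      by (auto simp: similarity_one similarity_mult add.commute)
  qed (auto intro: similarity_in_carrier)
  finally have "(?D ^^ 3) (carrier similarity_group) \<subseteq> {\<one>\<^bsub>similarity_group\<^esub>}"
    by (simp add: numeral_3_eq_3)
  moreover have "\<one>\<^bsub>similarity_group\<^esub> \<in> (?D ^^ 3) (carrier similarity_group)"
    by (intro subgroup.one_closed sim.exp_of_derived_is_subgroup sim.subgroup_self)
  ultimately show ?thesis
    unfolding sim.solvable_iff_trivial_derived_seq by blast
qed

text \<open>The constant term is \<open>b\<close> times a geometric sum, so it vanishes as soon as
  \<open>a ^ n = 1\<close>.\<close>

lemma similarity_rotation_pow:
  assumes "a \<noteq> 1"
  shows "similarity a b False [^]\<^bsub>similarity_group\<^esub> n =
    similarity (a ^ n) (b * (a ^ n - 1) / (a - 1)) False"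
  using assms by (induction n) (simp_all add: similarity_one similarity_mult field_simps)

lemma similarity_linear_pow:
  "similarity a 0 False [^]\<^bsub>similarity_group\<^esub> n = similarity (a ^ n) 0 False"
  by (induction n) (simp_all add: similarity_one similarity_mult mult.commute)

text \<open>By counting: there are \<open>n\<close> roots of \<open>z ^ n = 1\<close> and only
  \<open>d < n\<close> of \<open>z ^ d = 1\<close>.\<close>

lemma exists_root_of_unity:
  assumes "0 < d" "d < n"
  shows "\<exists>z::complex. z ^ n = 1 \<and> z ^ d \<noteq> 1"
proof (rule ccontr)
  assume "\<nexists>z::complex. z ^ n = 1 \<and> z ^ d \<noteq> 1"
  then have "card {z::complex. z ^ n = 1} \<le> card {z::complex. z ^ d = 1}"
    using assms by (intro card_mono finite_roots_unity) auto
  then show False using assms by (simp add: card_roots_unity_eq)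
qed


section \<open>Even Dyer groups\<close>

text \<open>Send \<open>v\<close> to \<open>x\<close>, \<open>w\<close> to \<open>y\<close> and
  every other vertex to the identity. An edge relation with a trivial end survives because its label
  is even; an odd label would force the other end to be trivial too.\<close>

lemma dyer_group_not_quasi_perfect:
  assumes dyer: "dyer_graph V E m f" and even: "even_dyer E m"
    and H: "group H" "solvable H"
    and vw: "v \<in> V" "w \<in> V" "v \<noteq> w"
    and xy: "x \<in> carrier H" "y \<in> carrier H" "x \<otimes>\<^bsub>H\<^esub> y \<noteq> y \<otimes>\<^bsub>H\<^esub> x"
    and x: "\<And>n. f v = enat n \<Longrightarrow> x [^]\<^bsub>H\<^esub> n = \<one>\<^bsub>H\<^esub>"
    and y: "\<And>n. f w = enat n \<Longrightarrow> y [^]\<^bsub>H\<^esub> n = \<one>\<^bsub>H\<^esub>"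
    and edge: "{v, w} \<in> E \<Longrightarrow>
      (x \<otimes>\<^bsub>H\<^esub> y) [^]\<^bsub>H\<^esub> (m {v, w} div 2) = (y \<otimes>\<^bsub>H\<^esub> x) [^]\<^bsub>H\<^esub> (m {v, w} div 2)"
  shows "\<not> quasi_perfect (dyer_group V E m f)"
proof
  assume qp: "quasi_perfect (dyer_group V E m f)"
  interpret dyer_graph V E m f by (rule dyer)
  interpret H: group H by (rule H(1))
  define g where "g u = (if u = v then x else if u = w then y else \<one>\<^bsub>H\<^esub>)" for u
  have g: "g u \<in> carrier H" for u using xy by (simp add: g_def)
  have rel: "word_eval H g r = word_eval H g s" if "(r, s) \<in> dyer_relations V E m f" for r s
    using that unfolding dyer_relations_def
  proof (elim UnE CollectE exE conjE)
    fix u n assume "(r, s) = (pos_word (replicate n u), [])" "f u = enat n"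
    then show ?thesis using x y H.word_eval_replicate[of g u n] g by (auto simp: g_def)
  next
    fix u u' assume rs: "(r, s) = (pos_word (alternating_word u u' (m {u, u'})),
      pos_word (alternating_word u' u (m {u, u'})))" and uu': "{u, u'} \<in> E"
    define k where "k = m {u, u'} div 2"
    have k: "m {u, u'} = 2 * k" using even uu' by (force simp: even_dyer_def k_def)
    have "u \<noteq> u'" using uu' edges_subset by auto
    \<comment> \<open>Either the edge is \<open>{v, w}\<close>, read in one of two orders, and
      \<open>edge\<close> applies, or one of the two images is the identity and the products
      agree.\<close>
    then have "(g u \<otimes>\<^bsub>H\<^esub> g u') [^]\<^bsub>H\<^esub> k = (g u' \<otimes>\<^bsub>H\<^esub> g u) [^]\<^bsub>H\<^esub> k"
      using edge uu' xy by (auto simp: g_def k_def insert_commute)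
    then show ?thesis using rs by (simp add: k H.word_eval_alternating g)
  qed
  obtain h where h: "h \<in> hom (dyer_group V E m f) H"
    "\<And>u. u \<in> V \<Longrightarrow> h (pres_gen V (dyer_relations V E m f) u) = g u"
    using H.presented_group_hom[of g V "dyer_relations V E m f"] g rel
    unfolding dyer_group_def by blast
  interpret group_hom "dyer_group V E m f" H h
    using h(1) H(1) group_presented_group
    by (auto simp: group_hom_def group_hom_axioms_def dyer_group_def)
  have "x \<otimes>\<^bsub>H\<^esub> y = y \<otimes>\<^bsub>H\<^esub> x"
    using quasi_perfect_hom_commute[OF qp H(2), of "pres_gen V (dyer_relations V E m f) v"
      "pres_gen V (dyer_relations V E m f) w"] h(2) vw
    by (simp add: dyer_group_def pres_gen_closed g_def)
  with xy(3) show False ..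
qed

text \<open>A relation of label 2 says that two generators commute, and completeness supplies one
  for each pair of distinct vertices. The inclusion also admits \<open>E = {}\<close>, where
  completeness leaves at most one vertex.\<close>

lemma dyer_group_comm_group:
  assumes "complete_graph V E" "m ` E \<subseteq> {2}"
  shows "comm_group (dyer_group V E m f)"
proof -
  let ?R = "dyer_relations V E m f"
  interpret group "dyer_group V E m f" unfolding dyer_group_def by (rule group_presented_group)
  have "pres_gen V ?R v \<otimes>\<^bsub>presented_group V ?R\<^esub> pres_gen V ?R w =
      pres_gen V ?R w \<otimes>\<^bsub>presented_group V ?R\<^esub> pres_gen V ?R v" if vw: "v \<in> V" "w \<in> V" for v w
  proof (cases "v = w")
    case False
    then have e: "{v, w} \<in> E" using assms(1) vw by (auto simp: complete_graph_def)
    then have "m {v, w} = 2" using assms(2) by auto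
    then have "([(v, True), (w, True)], [(w, True), (v, True)]) \<in> ?R"
      using e by (force simp: dyer_relations_def pos_word_def numeral_2_eq_2)
    then have "([(v, True), (w, True)], [(w, True), (v, True)]) \<in> pres_cong V ?R"
      using pres_cong.rel[of "[]" V "[]"] vw by fastforce
    then show ?thesis
      using vw equiv_class_eq[OF equiv_pres_cong] by (simp add: pres_gen_def presented_group_mult)
  qed simp
  then show ?thesis
    using generate_pres_gen[of V ?R] pres_gen_closed[of _ V ?R]
    by (intro comm_group_if_generators_commute[of "pres_gen V ?R ` V"]) (auto simp: dyer_group_def)
qed

text \<open>Only the orders of the two images are constrained. The maps \<open>p * z\<close> and
  \<open>q * z + 1\<close> have orders dividing the finite labels and distinct fixed points 0 and
  \<open>1 / (1 - q)\<close>, so they do not commute.\<close>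

lemma not_adjacent_not_quasi_perfect:
  assumes dyer: "dyer_graph V E m f" "even_dyer E m"
    and vw: "v \<in> V" "w \<in> V" "v \<noteq> w" "{v, w} \<notin> E"
  shows "\<not> quasi_perfect (dyer_group V E m f)"
proof -
  interpret dyer_graph V E m f by (rule dyer(1))
  have root: "\<exists>z::complex. z \<noteq> 0 \<and> z \<noteq> 1 \<and> (\<forall>n. f u = enat n \<longrightarrow> z ^ n = 1)"
    if u: "u \<in> V" for u
  proof (cases "f u")
    case (enat n)
    then have "2 \<le> n" using vertex_label[OF u] by (simp add: numeral_eq_enat)
    then obtain z :: complex where "z ^ n = 1" "z ^ 1 \<noteq> 1"
      using exists_root_of_unity[of 1 n] by auto
    then show ?thesis using enat \<open>2 \<le> n\<close> by (auto intro!: exI[of _ z] simp: power_0_left)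
  \<comment> \<open>For \<open>f u = \<infinity>\<close> there is no condition on the order; -1 is
    merely some number other than 0 and 1.\<close>
  qed (auto intro: exI[of _ "-1"])
  obtain p q :: complex
    where p: "p \<noteq> 0" "p \<noteq> 1" "\<And>n. f v = enat n \<Longrightarrow> p ^ n = 1"
      and q: "q \<noteq> 0" "q \<noteq> 1" "\<And>n. f w = enat n \<Longrightarrow> q ^ n = 1"
    using root[OF vw(1)] root[OF vw(2)] by blast
  have "similarity p 0 False \<otimes>\<^bsub>similarity_group\<^esub> similarity q 1 False \<noteq>
      similarity q 1 False \<otimes>\<^bsub>similarity_group\<^esub> similarity p 0 False"
  proof
    assume "similarity p 0 False \<otimes>\<^bsub>similarity_group\<^esub> similarity q 1 False =
      similarity q 1 False \<otimes>\<^bsub>similarity_group\<^esub> similarity p 0 False"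
    \<comment> \<open>At 0 the two products take the values \<open>p\<close> and 1.\<close>
    from fun_cong[OF this, of 0] p(2) show False by (simp add: similarity_mult similarity_def)
  qed
  then show ?thesis
    using p q vw
    by (intro dyer_group_not_quasi_perfect[OF dyer group_similarity_group
          solvable_similarity_group vw(1-3), of "similarity p 0 False" "similarity q 1 False"])
      (auto simp: similarity_in_carrier similarity_linear_pow similarity_rotation_pow similarity_one)
qed

text \<open>Use the reflections \<open>cnj t\<close> and \<open>z * cnj t\<close> with
  \<open>norm z = 1\<close>. Their products in the two orders are multiplication by
  \<open>cnj z\<close>, which is \<open>inverse z\<close>, and by \<open>z\<close>: these differ if
  \<open>z ^ 2 \<noteq> 1\<close>, but have equal \<open>k\<close>-th powers if
  \<open>z ^ (2 * k) = 1\<close>.\<close>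

lemma edge_label_not_2_not_quasi_perfect:
  assumes dyer: "dyer_graph V E m f" "even_dyer E m"
    and e: "e \<in> E" "m e \<noteq> 2"
  shows "\<not> quasi_perfect (dyer_group V E m f)"
proof -
  interpret dyer_graph V E m f by (rule dyer(1))
  obtain v w where vw: "v \<in> V" "w \<in> V" "v \<noteq> w" and e_eq: "e = {v, w}"
    using e(1) edges_subset by blast
  have f2: "f v = 2" "f w = 2" using labels_compatible[of v w] e by (simp_all add: e_eq)
  define k where "k = m e div 2"
  have k: "m e = 2 * k" using dyer(2) e by (force simp: even_dyer_def k_def)
  have "2 < m e" using edge_label[OF e(1)] e(2) by simp
  then obtain z :: complex where z: "z ^ (2 * k) = 1" "z ^ 2 \<noteq> 1"
    using exists_root_of_unity[of 2 "m e"] by (auto simp: k)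
  \<comment> \<open>Norm 1 makes \<open>?y\<close> an involution, as the vertex label 2
    requires.\<close>
  have "norm z = 1" using z(1) \<open>2 < m e\<close> k power_eq_1_iff[of z "2 * k"] by simp
  then have conj: "z * cnj z = 1" using complex_norm_square[of z] by simp
  then have "z \<noteq> 0" by auto
  let ?x = "similarity 1 0 True" and ?y = "similarity z 0 True"
  have "cnj z = inverse z" using conj \<open>z \<noteq> 0\<close> by (simp add: field_simps)
  have "z ^ k * z ^ k = 1" using z(1) by (simp add: mult_2 power_add)
  \<comment> \<open>\<open>z ^ k\<close> squares to 1, so the rotations by \<open>z\<close> and by
    its inverse have the same \<open>k\<close>-th power.\<close>
  then have zk: "inverse (z ^ k) = z ^ k" by (simp add: inverse_unique)
  have order_2: "similarity c 0 True [^]\<^bsub>similarity_group\<^esub> n = \<one>\<^bsub>similarity_group\<^esub>"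
    if "enat n = 2" "c * cnj c = 1" for c n
    using that by (auto simp: numeral_eq_enat numeral_2_eq_2 similarity_mult similarity_one)
  have "?x \<otimes>\<^bsub>similarity_group\<^esub> ?y \<noteq> ?y \<otimes>\<^bsub>similarity_group\<^esub> ?x"
  proof
    assume "?x \<otimes>\<^bsub>similarity_group\<^esub> ?y = ?y \<otimes>\<^bsub>similarity_group\<^esub> ?x"
    \<comment> \<open>At 1 the products take the values \<open>cnj z\<close> and \<open>z\<close>.
      If these agree, then \<open>z ^ 2 = z * cnj z = 1\<close>, against the choice of
      \<open>z\<close>.\<close>
    from fun_cong[OF this, of 1] have "cnj z = z" by (simp add: similarity_mult similarity_def)
    with conj z(2) show False by (simp add: power2_eq_square)
  qed
  moreover have "(?x \<otimes>\<^bsub>similarity_group\<^esub> ?y) [^]\<^bsub>similarity_group\<^esub> k =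
      (?y \<otimes>\<^bsub>similarity_group\<^esub> ?x) [^]\<^bsub>similarity_group\<^esub> k"
    using \<open>cnj z = inverse z\<close> zk
    by (simp add: similarity_mult similarity_linear_pow power_inverse)
  ultimately show ?thesis
    using f2 conj \<open>z \<noteq> 0\<close> k
    by (intro dyer_group_not_quasi_perfect[OF dyer group_similarity_group
          solvable_similarity_group vw, of ?x ?y])
      (auto simp: e_eq similarity_in_carrier order_2)
qed

theorem proposition3p6:
  fixes V :: "'a set" and E :: "'a set set" and m :: "'a set \<Rightarrow> nat" and f :: "'a \<Rightarrow> enat"
  assumes "dyer_graph V E m f"
    and "even_dyer E m"
  shows "quasi_perfect (dyer_group V E m f) \<longleftrightarrow>
    complete_graph V E \<and> (E = {} \<or> m ` E = {2})"
proof
  assume qp: "quasi_perfect (dyer_group V E m f)"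
  have "complete_graph V E"
    using not_adjacent_not_quasi_perfect[OF assms] qp by (auto simp: complete_graph_def)
  moreover have "m ` E \<subseteq> {2}"
    using edge_label_not_2_not_quasi_perfect[OF assms] qp by auto
  ultimately show "complete_graph V E \<and> (E = {} \<or> m ` E = {2})" by auto
next
  assume "complete_graph V E \<and> (E = {} \<or> m ` E = {2})"
  then show "quasi_perfect (dyer_group V E m f)"
    by (intro comm_group.quasi_perfect dyer_group_comm_group) auto
qed

end
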